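(* Let $\lambda\in\mathbf{k}$, let $(\mathfrak{A},[-,-,-],\mathrm{d})$ be a modified $\lambda$-differential 3-Lie algebra, and let $(f,g)\in\mathrm{Hom}(\wedge^3\mathfrak{A},\mathfrak{A}^* )\oplus\mathrm{Hom}(\mathfrak{A},\mathfrak{A}^* )$ be such that the $T^*$-extension $T^*_{(f,g)}(\mathfrak{A})=(\mathfrak{A}\oplus\mathfrak{A}^*,[-,-,-]_f,\mathrm{d}_g)$ is a modified $\lambda$-differential 3-Lie algebra. Let $\varpi$ be the bilinear form on $\mathfrak{A}\oplus\mathfrak{A}^*$ given by $\varpi(a_1+\alpha_1,a_2+\alpha_2)=\alpha_1(a_2)+\alpha_2(a_1)$ for $a_1,a_2\in\mathfrak{A}$, $\alpha_1,\alpha_2\in\mathfrak{A}^*$. Then $(T^*_{(f,g)}(\mathfrak{A}),\varpi)$ is a metrised modified $\lambda$-differential 3-Lie algebra if and only if $$f(a_1,a_2,a_3)(a_4)+f(a_1,a_2,a_4)(a_3)=0,\qquad g(a_1)(a_2)+g(a_2)(a_1)=0,\qquad\forall\, a_1,a_2,a_3,a_4\in\mathfrak{A}.$$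
   Context: Throughout, $\mathbf{k}$ is a field of characteristic zero; all vector spaces and linear maps are over $\mathbf{k}$; $\mathfrak{A}^*$ is the dual space of $\mathfrak{A}$. 3-Lie algebra: a vector space $\mathfrak{A}$ with a skew-symmetric trilinear bracket $[-,-,-]:\wedge^3\mathfrak{A}\to\mathfrak{A}$ satisfying $[a_1,a_2,[a_3,a_4,a_5]]=[[a_1,a_2,a_3],a_4,a_5]+[a_3,[a_1,a_2,a_4],a_5]+[a_3,a_4,[a_1,a_2,a_5]]$. Modified $\lambda$-differential 3-Lie algebra: a triple $(\mathfrak{A},[-,-,-],\mathrm{d})$ with $(\mathfrak{A},[-,-,-])$ a 3-Lie algebra and $\mathrm{d}:\mathfrak{A}\to\mathfrak{A}$ linear such that $\mathrm{d}[a_1,a_2,a_3]=[\mathrm{d}(a_1),a_2,a_3]+[a_1,\mathrm{d}(a_2),a_3]+[a_1,a_2,\mathrm{d}(a_3)]+\lambda[a_1,a_2,a_3]$. Dual adjoint maps: $ad^*(a_1,a_2)\in\mathrm{End}(\mathfrak{A}^* )$ is given by $(ad^*(a_1,a_2)\alpha)(b)=-\alpha([a_1,a_2,b])$, and $\mathrm{d}^*:\mathfrak{A}^*\to\mathfrak{A}^*$ by $(\mathrm{d}^*\alpha)(b)=\alpha(\mathrm{d}(b))$. $T^*$-extension operations on $\mathfrak{A}\oplus\mathfrak{A}^*$: $[a_1+\alpha_1,a_2+\alpha_2,a_3+\alpha_3]_f=[a_1,a_2,a_3]+ad^*(a_2,a_3)\alpha_1+ad^*(a_3,a_1)\alpha_2+ad^*(a_1,a_2)\alpha_3+f(a_1,a_2,a_3)$,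 $\mathrm{d}_g(a_1+\alpha_1)=\mathrm{d}(a_1)-\mathrm{d}^*(\alpha_1)+g(a_1)$. When these make $\mathfrak{A}\oplus\mathfrak{A}^*$ a modified $\lambda$-differential 3-Lie algebra, it is called the $T^*$-extension $T^*_{(f,g)}(\mathfrak{A})$. Metrised: a modified $\lambda$-differential 3-Lie algebra $(\mathfrak{B},[-,-,-],\mathrm{d})$ together with a bilinear form $\varpi_{\mathfrak{B}}:\mathfrak{B}\times\mathfrak{B}\to\mathbf{k}$ is metrised if $\varpi_{\mathfrak{B}}$ is symmetric, non-degenerate (i.e. $\varpi_{\mathfrak{B}}(x,y)=0$ for all $y$ implies $x=0$), and for all $b_1,b_2,b_3,b_4\in\mathfrak{B}$: $\varpi_{\mathfrak{B}}([b_1,b_2,b_3],b_4)+\varpi_{\mathfrak{B}}(b_3,[b_1,b_2,b_4])=0$ and $\varpi_{\mathfrak{B}}(\mathrm{d}(b_1),b_2)+\varpi_{\mathfrak{B}}(b_1,\mathrm{d}(b_2))=0$. *)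

theory Defs
  imports
    Complex_Main
    "HOL-Library.Product_Plus"
    "HOL-Library.Function_Algebras"
begin

text \<open>
  The vector space \<open>A\<close> is a type with a scalar multiplication satisfying \<open>vector_space\<close>.  Its dual
  depends on that scalar multiplication and so is not a type; it is a subspace of the space of all
  functions from \<open>A\<close> to the ground field.  For this reason the algebraic structures below live on
  a subspace \<open>V\<close> of an ambient vector space.  They are used with \<open>V = UNIV\<close> for \<open>A\<close> itself, and
  with \<open>V = UNIV \<times> dual_space scale\<close> for the direct sum of \<open>A\<close> and its dual.
\<close>

locale linear_subspace = vector_space scale
  for scale :: "'k::field \<Rightarrow> 'v::ab_group_add \<Rightarrow> 'v" +
  fixes V :: "'v set"
  assumes subspace_carrier: "subspace V"

definition linear_map_on ::
  "('k::field \<Rightarrow> 'v::ab_group_add \<Rightarrow> 'v) \<Rightarrow> ('k \<Rightarrow> 'w::ab_group_add \<Rightarrow> 'w)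
    \<Rightarrow> 'v set \<Rightarrow> 'w set \<Rightarrow> ('v \<Rightarrow> 'w) \<Rightarrow> bool" where
  "linear_map_on s1 s2 V W h \<longleftrightarrow>
     (\<forall>x\<in>V. h x \<in> W) \<and>
     (\<forall>x\<in>V. \<forall>y\<in>V. h (x + y) = h x + h y) \<and>
     (\<forall>c. \<forall>x\<in>V. h (s1 c x) = s2 c (h x))"

definition trilinear_map_on ::
  "('k::field \<Rightarrow> 'v::ab_group_add \<Rightarrow> 'v) \<Rightarrow> ('k \<Rightarrow> 'w::ab_group_add \<Rightarrow> 'w)
    \<Rightarrow> 'v set \<Rightarrow> 'w set \<Rightarrow> ('v \<Rightarrow> 'v \<Rightarrow> 'v \<Rightarrow> 'w) \<Rightarrow> bool" where
  "trilinear_map_on s1 s2 V W m \<longleftrightarrow>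
     (\<forall>y\<in>V. \<forall>z\<in>V. linear_map_on s1 s2 V W (\<lambda>x. m x y z)) \<and>
     (\<forall>x\<in>V. \<forall>z\<in>V. linear_map_on s1 s2 V W (\<lambda>y. m x y z)) \<and>
     (\<forall>x\<in>V. \<forall>y\<in>V. linear_map_on s1 s2 V W (\<lambda>z. m x y z))"

text \<open>
  Linear maps on the third exterior power of \<open>V\<close> are represented by the corresponding trilinear
  maps.  The two adjacent transpositions generate all permutations of the arguments, and over a
  field of characteristic zero skew-symmetric and alternating maps coincide.
\<close>

definition skew_trilinear_map_on ::
  "('k::field \<Rightarrow> 'v::ab_group_add \<Rightarrow> 'v) \<Rightarrow> ('k \<Rightarrow> 'w::ab_group_add \<Rightarrow> 'w)
    \<Rightarrow> 'v set \<Rightarrow> 'w set \<Rightarrow> ('v \<Rightarrow> 'v \<Rightarrow> 'v \<Rightarrow> 'w) \<Rightarrow> bool" where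
  "skew_trilinear_map_on s1 s2 V W m \<longleftrightarrow>
     trilinear_map_on s1 s2 V W m \<and>
     (\<forall>x\<in>V. \<forall>y\<in>V. \<forall>z\<in>V. m y x z = - m x y z \<and> m x z y = - m x y z)"

definition bilinear_form_on ::
  "('k::field \<Rightarrow> 'v::ab_group_add \<Rightarrow> 'v) \<Rightarrow> 'v set \<Rightarrow> ('v \<Rightarrow> 'v \<Rightarrow> 'k) \<Rightarrow> bool" where
  "bilinear_form_on s V w \<longleftrightarrow>
     (\<forall>y\<in>V. linear_map_on s (*) V UNIV (\<lambda>x. w x y)) \<and>
     (\<forall>x\<in>V. linear_map_on s (*) V UNIV (\<lambda>y. w x y))"

locale three_Lie_algebra = linear_subspace scale V
  for scale :: "'k::field_char_0 \<Rightarrow> 'v::ab_group_add \<Rightarrow> 'v" and V :: "'v set" +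
  fixes br :: "'v \<Rightarrow> 'v \<Rightarrow> 'v \<Rightarrow> 'v"
  assumes bracket_skew_trilinear: "skew_trilinear_map_on scale scale V V br"
    and fundamental_identity:
      "\<lbrakk>a1 \<in> V; a2 \<in> V; a3 \<in> V; a4 \<in> V; a5 \<in> V\<rbrakk> \<Longrightarrow>
       br a1 a2 (br a3 a4 a5) =
         br (br a1 a2 a3) a4 a5 + br a3 (br a1 a2 a4) a5 + br a3 a4 (br a1 a2 a5)"

locale modified_differential_three_Lie_algebra = three_Lie_algebra scale V br
  for scale :: "'k::field_char_0 \<Rightarrow> 'v::ab_group_add \<Rightarrow> 'v" and V :: "'v set"
    and br :: "'v \<Rightarrow> 'v \<Rightarrow> 'v \<Rightarrow> 'v" +
  fixes lam :: 'k and d :: "'v \<Rightarrow> 'v"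
  assumes differential_linear: "linear_map_on scale scale V V d"
    and differential_bracket:
      "\<lbrakk>a1 \<in> V; a2 \<in> V; a3 \<in> V\<rbrakk> \<Longrightarrow>
       d (br a1 a2 a3) =
         br (d a1) a2 a3 + br a1 (d a2) a3 + br a1 a2 (d a3) + scale lam (br a1 a2 a3)"

locale metrised_modified_differential_three_Lie_algebra =
  modified_differential_three_Lie_algebra scale V br lam d
  for scale :: "'k::field_char_0 \<Rightarrow> 'v::ab_group_add \<Rightarrow> 'v" and V :: "'v set"
    and br :: "'v \<Rightarrow> 'v \<Rightarrow> 'v \<Rightarrow> 'v" and lam :: 'k and d :: "'v \<Rightarrow> 'v" +
  fixes form :: "'v \<Rightarrow> 'v \<Rightarrow> 'k"
  assumes form_bilinear: "bilinear_form_on scale V form"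
    and form_symmetric: "\<lbrakk>x \<in> V; y \<in> V\<rbrakk> \<Longrightarrow> form x y = form y x"
    and form_nondegenerate: "\<lbrakk>x \<in> V; \<And>y. y \<in> V \<Longrightarrow> form x y = 0\<rbrakk> \<Longrightarrow> x = 0"
    and form_bracket:
      "\<lbrakk>b1 \<in> V; b2 \<in> V; b3 \<in> V; b4 \<in> V\<rbrakk> \<Longrightarrow>
       form (br b1 b2 b3) b4 + form b3 (br b1 b2 b4) = 0"
    and form_differential:
      "\<lbrakk>b1 \<in> V; b2 \<in> V\<rbrakk> \<Longrightarrow> form (d b1) b2 + form b1 (d b2) = 0"

definition dual_space :: "('k::field \<Rightarrow> 'a::ab_group_add \<Rightarrow> 'a) \<Rightarrow> ('a \<Rightarrow> 'k) set" where
  "dual_space scale = {\<alpha>. Vector_Spaces.linear scale (*) \<alpha>}"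

definition fun_scale :: "'k::field \<Rightarrow> ('a \<Rightarrow> 'k) \<Rightarrow> ('a \<Rightarrow> 'k)" where
  "fun_scale c \<alpha> = (\<lambda>b. c * \<alpha> b)"

definition dual_ad ::
  "('a \<Rightarrow> 'a \<Rightarrow> 'a \<Rightarrow> 'a) \<Rightarrow> 'a \<Rightarrow> 'a \<Rightarrow> ('a \<Rightarrow> 'k::field) \<Rightarrow> ('a \<Rightarrow> 'k)" where
  "dual_ad br a1 a2 \<alpha> = (\<lambda>b. - \<alpha> (br a1 a2 b))"

definition dual_map :: "('a \<Rightarrow> 'a) \<Rightarrow> ('a \<Rightarrow> 'k::field) \<Rightarrow> ('a \<Rightarrow> 'k)" where
  "dual_map d \<alpha> = (\<lambda>b. \<alpha> (d b))"

definition Tstar_carrier ::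
  "('k::field \<Rightarrow> 'a::ab_group_add \<Rightarrow> 'a) \<Rightarrow> ('a \<times> ('a \<Rightarrow> 'k)) set" where
  "Tstar_carrier scale = UNIV \<times> dual_space scale"

fun Tstar_scale ::
  "('k::field \<Rightarrow> 'a::ab_group_add \<Rightarrow> 'a) \<Rightarrow> 'k \<Rightarrow> 'a \<times> ('a \<Rightarrow> 'k) \<Rightarrow> 'a \<times> ('a \<Rightarrow> 'k)" where
  "Tstar_scale scale c (a, \<alpha>) = (scale c a, fun_scale c \<alpha>)"

fun Tstar_bracket ::
  "('a \<Rightarrow> 'a \<Rightarrow> 'a \<Rightarrow> 'a) \<Rightarrow> ('a \<Rightarrow> 'a \<Rightarrow> 'a \<Rightarrow> ('a \<Rightarrow> 'k::field))
    \<Rightarrow> 'a \<times> ('a \<Rightarrow> 'k) \<Rightarrow> 'a \<times> ('a \<Rightarrow> 'k) \<Rightarrow> 'a \<times> ('a \<Rightarrow> 'k) \<Rightarrow> 'a \<times> ('a \<Rightarrow> 'k)" where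
  "Tstar_bracket br f (a1, \<alpha>1) (a2, \<alpha>2) (a3, \<alpha>3) =
     (br a1 a2 a3,
      dual_ad br a2 a3 \<alpha>1 + dual_ad br a3 a1 \<alpha>2 + dual_ad br a1 a2 \<alpha>3 + f a1 a2 a3)"

fun Tstar_differential ::
  "('a \<Rightarrow> 'a) \<Rightarrow> ('a \<Rightarrow> ('a \<Rightarrow> 'k::field)) \<Rightarrow> 'a \<times> ('a \<Rightarrow> 'k) \<Rightarrow> 'a \<times> ('a \<Rightarrow> 'k)" where
  "Tstar_differential d g (a, \<alpha>) = (d a, - dual_map d \<alpha> + g a)"

fun Tstar_form :: "'a \<times> ('a \<Rightarrow> 'k::field) \<Rightarrow> 'a \<times> ('a \<Rightarrow> 'k) \<Rightarrow> 'k" where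
  "Tstar_form (a1, \<alpha>1) (a2, \<alpha>2) = \<alpha>1 a2 + \<alpha>2 a1"

end

theory Submission
  imports Defs
begin

text \<open>
  The form \<open>\<varpi>\<close> is nondegenerate because linear forms separate the points of \<open>A\<close>.
  When the two invariance conditions for \<open>\<varpi>\<close> are expanded, all contributions of the dual
  components \<open>\<alpha>\<^sub>i\<close> cancel by skew-symmetry of the bracket, and what is left is exactly the
  pair of conditions on \<open>f\<close> and \<open>g\<close>.
\<close>

lemma dual_spaceD:
  assumes "\<alpha> \<in> dual_space scale"
  shows "\<alpha> (x + y) = \<alpha> x + \<alpha> y" and "\<alpha> (scale c x) = c * \<alpha> x"
    and "\<alpha> (- x) = - \<alpha> x" and "\<alpha> 0 = 0"
proof -
  interpret Vector_Spaces.linear scale "(*)" \<alpha>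
    using assms by (simp add: dual_space_def)
  show "\<alpha> (x + y) = \<alpha> x + \<alpha> y" "\<alpha> (scale c x) = c * \<alpha> x" "\<alpha> (- x) = - \<alpha> x" "\<alpha> 0 = 0"
    by (simp_all add: add scale neg)
qed

text \<open>The ground field is a vector space over itself, so general facts on linear maps between
  two spaces apply to functionals.\<close>

lemma vector_space_pair_dual:
  assumes "vector_space scale"
  shows "vector_space_pair scale (*)"
  using assms by (rule vector_space_pair.intro) (unfold_locales, simp_all add: algebra_simps)

lemma zero_mem_dual_space:
  assumes "vector_space scale"
  shows "0 \<in> dual_space scale"
proof -
  interpret vector_space_pair scale "(*)"
    using assms by (rule vector_space_pair_dual)
  show ?thesis
    by (simp add: dual_space_def zero_fun_def linear_zero)
qed

lemma dual_space_separates: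
  fixes scale :: "'k::field \<Rightarrow> 'a::ab_group_add \<Rightarrow> 'a"
  assumes "vector_space scale" and "a \<noteq> 0"
  obtains \<alpha> where "\<alpha> \<in> dual_space scale" "\<alpha> a = 1"
proof -
  interpret vector_space_pair scale "(*)"
    using assms(1) by (rule vector_space_pair_dual)
  have "vs1.independent {a}"
    using assms(2) by simp
  \<comment> \<open>A nonzero vector forms an independent singleton, so prescribing the value 1 on
    it extends to a linear functional.\<close>
  then show thesis
    using linear_independent_extend[of "{a}" "\<lambda>_. 1"] that by (auto simp: dual_space_def)
qed

lemma Tstar_form_symmetric: "Tstar_form x y = Tstar_form y x"
  by (cases x; cases y) (simp add: add.commute)

lemma Tstar_form_bilinear:
  "bilinear_form_on (Tstar_scale scale) (Tstar_carrier scale) Tstar_form"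
  by (auto simp: bilinear_form_on_def linear_map_on_def Tstar_carrier_def fun_scale_def
      dual_spaceD algebra_simps)

lemma Tstar_form_nondegenerate:
  assumes "vector_space scale" and "x \<in> Tstar_carrier scale"
    and orth: "\<And>y. y \<in> Tstar_carrier scale \<Longrightarrow> Tstar_form x y = 0"
  shows "x = 0"
proof -
  obtain a \<alpha> where x: "x = (a, \<alpha>)" and \<alpha>: "\<alpha> \<in> dual_space scale"
    using assms(2) by (auto simp: Tstar_carrier_def)
  \<comment> \<open>Pairing with \<open>(b, 0)\<close> isolates the value of \<open>\<alpha>\<close>
    at \<open>b\<close>.\<close>
  have "\<alpha> b = 0" for b
    using orth[of "(b, 0)"] zero_mem_dual_space[OF assms(1)] by (simp add: x Tstar_carrier_def)
  moreover have "a = 0"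
  proof (rule ccontr)
    assume "a \<noteq> 0"
    then obtain \<beta> where "\<beta> \<in> dual_space scale" "\<beta> a = 1"
      using dual_space_separates[OF assms(1)] by blast
    \<comment> \<open>Pairing with \<open>(0, \<beta>)\<close> leaves \<open>\<beta> a\<close>
      alone, because \<open>\<alpha> 0 = 0\<close>; this value would be both 0 and 1.\<close>
    then show False
      using orth[of "(0, \<beta>)"] \<alpha> by (simp add: x Tstar_carrier_def dual_spaceD)
  qed
  ultimately show ?thesis
    by (simp add: x zero_prod_def fun_eq_iff)
qed

text \<open>The terms in \<open>\<alpha>3\<close> and \<open>\<alpha>4\<close> cancel in pairs
  through the minus sign in \<open>dual_ad\<close>. Those in \<open>\<alpha>1\<close> and
  \<open>\<alpha>2\<close> are evaluated at brackets with \<open>a3\<close> and \<open>a4\<close>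
  exchanged; linearity of these functionals turns skew-symmetry into cancellation.\<close>

lemma Tstar_form_bracket:
  assumes skew: "\<And>x y z. br y x z = - br x y z" "\<And>x y z. br x z y = - br x y z"
    and "\<alpha>1 \<in> dual_space scale" "\<alpha>2 \<in> dual_space scale"
  shows "Tstar_form (Tstar_bracket br f (a1, \<alpha>1) (a2, \<alpha>2) (a3, \<alpha>3)) (a4, \<alpha>4)
      + Tstar_form (a3, \<alpha>3) (Tstar_bracket br f (a1, \<alpha>1) (a2, \<alpha>2) (a4, \<alpha>4))
      = f a1 a2 a3 a4 + f a1 a2 a4 a3"
proof -
  have "br a2 a4 a3 = - br a2 a3 a4"
    by (rule skew)
  \<comment> \<open>Exchanging the outer arguments is a product of three adjacent transpositions,
    hence odd.\<close>
  moreover have "br a4 a1 a3 = - br a3 a1 a4"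
    using skew(1)[of a1 a4 a3] skew(2)[of a1 a3 a4] skew(1)[of a3 a1 a4] by simp
  ultimately show ?thesis
    using assms(3,4) by (simp add: dual_ad_def dual_spaceD)
qed

text \<open>The sign of \<open>dual_map d\<close> in \<open>Tstar_differential\<close> makes the
  terms \<open>\<alpha>1 (d a2)\<close> and \<open>\<alpha>2 (d a1)\<close> cancel.\<close>

lemma Tstar_form_differential:
  "Tstar_form (Tstar_differential d g (a1, \<alpha>1)) (a2, \<alpha>2)
    + Tstar_form (a1, \<alpha>1) (Tstar_differential d g (a2, \<alpha>2)) = g a1 a2 + g a2 a1"
  by (simp add: dual_map_def)

theorem proposition5p4:
  fixes scale :: "'k::field_char_0 \<Rightarrow> 'a::ab_group_add \<Rightarrow> 'a"
    and br :: "'a \<Rightarrow> 'a \<Rightarrow> 'a \<Rightarrow> 'a"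
    and lam :: 'k
    and d :: "'a \<Rightarrow> 'a"
    and f :: "'a \<Rightarrow> 'a \<Rightarrow> 'a \<Rightarrow> ('a \<Rightarrow> 'k)"
    and g :: "'a \<Rightarrow> ('a \<Rightarrow> 'k)"
  assumes "modified_differential_three_Lie_algebra scale UNIV br lam d"
    and "skew_trilinear_map_on scale fun_scale UNIV (dual_space scale) f"
    and "linear_map_on scale fun_scale UNIV (dual_space scale) g"
    and "modified_differential_three_Lie_algebra
           (Tstar_scale scale) (Tstar_carrier scale) (Tstar_bracket br f) lam
           (Tstar_differential d g)"
  shows "metrised_modified_differential_three_Lie_algebra
           (Tstar_scale scale) (Tstar_carrier scale) (Tstar_bracket br f) lam
           (Tstar_differential d g) Tstar_form
         \<longleftrightarrow> (\<forall>a1 a2 a3 a4. f a1 a2 a3 a4 + f a1 a2 a4 a3 = 0) \<and>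
             (\<forall>a1 a2. g a1 a2 + g a2 a1 = 0)"
proof -
  interpret A: modified_differential_three_Lie_algebra scale UNIV br lam d
    by fact
  have vs: "vector_space scale"
    by (fact A.vector_space_axioms)
  have skew: "br y x z = - br x y z" "br x z y = - br x y z" for x y z
    using A.bracket_skew_trilinear unfolding skew_trilinear_map_on_def by blast+
  note bracket = Tstar_form_bracket[of br, OF skew]
  \<comment> \<open>What remains of each invariance condition depends only on the components in
    \<open>A\<close>, so testing on vectors \<open>(a, 0)\<close> recovers the conditions on
    \<open>f\<close> and \<open>g\<close>.\<close>
  have zero: "(a, 0) \<in> Tstar_carrier scale" for a
    using zero_mem_dual_space[OF vs] by (simp add: Tstar_carrier_def)
  show ?thesis
  proof (intro iffI conjI allI)
    assume "metrised_modified_differential_three_Lie_algebra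
           (Tstar_scale scale) (Tstar_carrier scale) (Tstar_bracket br f) lam
           (Tstar_differential d g) Tstar_form"
    then interpret M: metrised_modified_differential_three_Lie_algebra
           "Tstar_scale scale" "Tstar_carrier scale" "Tstar_bracket br f" lam
           "Tstar_differential d g" Tstar_form .
    show "f a1 a2 a3 a4 + f a1 a2 a4 a3 = 0" for a1 a2 a3 a4
      using M.form_bracket[OF zero zero zero zero, of a1 a2 a3 a4]
      by (simp only: bracket[OF zero_mem_dual_space[OF vs] zero_mem_dual_space[OF vs]])
    show "g a1 a2 + g a2 a1 = 0" for a1 a2
      using M.form_differential[OF zero zero, of a1 a2]
      by (simp only: Tstar_form_differential)
  next
    assume fg: "(\<forall>a1 a2 a3 a4. f a1 a2 a3 a4 + f a1 a2 a4 a3 = 0) \<and>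
             (\<forall>a1 a2. g a1 a2 + g a2 a1 = 0)"
    show "metrised_modified_differential_three_Lie_algebra
           (Tstar_scale scale) (Tstar_carrier scale) (Tstar_bracket br f) lam
           (Tstar_differential d g) Tstar_form"
    \<comment> \<open>Among the properties of the form, only the two invariance identities draw on
      \<open>fg\<close>; bilinearity, symmetry and nondegeneracy hold for every \<open>f\<close> and
      \<open>g\<close>.\<close>
    proof (intro metrised_modified_differential_three_Lie_algebra.intro
        metrised_modified_differential_three_Lie_algebra_axioms.intro)
      show "Tstar_form (Tstar_bracket br f b1 b2 b3) b4
          + Tstar_form b3 (Tstar_bracket br f b1 b2 b4) = 0"
        if "b1 \<in> Tstar_carrier scale" "b2 \<in> Tstar_carrier scale" for b1 b2 b3 b4
      proof -
        have "snd b1 \<in> dual_space scale" "snd b2 \<in> dual_space scale"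
          using that by (auto simp: Tstar_carrier_def)
        then show ?thesis
          using bracket[of "snd b1" scale "snd b2" f "fst b1" "fst b2" "fst b3" "snd b3"
              "fst b4" "snd b4"] fg
          by simp
      qed
      show "Tstar_form (Tstar_differential d g b1) b2
          + Tstar_form b1 (Tstar_differential d g b2) = 0" for b1 b2
        using Tstar_form_differential[of d g "fst b1" "snd b1" "fst b2" "snd b2"] fg by simp
      show "x = 0" if "x \<in> Tstar_carrier scale"
          "\<And>y. y \<in> Tstar_carrier scale \<Longrightarrow> Tstar_form x y = 0" for x
        using vs that by (rule Tstar_form_nondegenerate)
    qed (fact assms(4) Tstar_form_bilinear | rule Tstar_form_symmetric)+
  qed
qed

end
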